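(* Let $(k,\delta)$ be a differentially closed field with $\delta\neq 0$. Then the ring $k[\delta]$ is fadelian and is not a division ring.
   Context: A ring $A$ (unital, $1\ne 0$, not necessarily commutative) is fadelian if for every $x\in A$ and every nonzero $a\in A$ there exist $b,c\in A$ with $x=ab+ca$. A differential field is a commutative field $k$ of characteristic $0$ with an additive map $\delta:k\to k$ satisfying $\delta(ab)=\delta(a)b+a\delta(b)$. It is differentially closed if for all differential polynomials $f,g\in k\{X\}=k[X,X',X'',\ldots]$ with $g\neq 0$ and the order of $f$ strictly larger than the order of $g$, there is $x\in k$ with $f(x)=0$ and $g(x)\neq 0$. Here the order of a differential polynomial not in $k$ is the largest $n$ such that $X^{(n)}$ occurs in it, and elements of $k$ have order $-1$. For $x\in k$, let $\tilde x:k\to k$, $y\mapsto xy$. Then $k[\delta]$ denotes the subring of the ring of additive endomorphisms of $k$ (with composition as multiplication) generated by $\delta$ and all $\tilde x$, $x\in k$. *)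

theory Defs
  imports Complex_Main "HOL-Library.Poly_Mapping" "HOL-Algebra.Generated_Rings"
begin

locale fadelian_ring = ring +
  assumes one_not_zero: "\<one> \<noteq> \<zero>"
    and fadelian: "\<lbrakk>x \<in> carrier R; a \<in> carrier R; a \<noteq> \<zero>\<rbrakk>
      \<Longrightarrow> \<exists>b\<in>carrier R. \<exists>c\<in>carrier R. x = a \<otimes> b \<oplus> c \<otimes> a"

text \<open>Division rings, under a name that does not clash with the type class of the distribution.\<close>

locale skew_field = ring +
  assumes one_not_zero: "\<one> \<noteq> \<zero>"
    and nonzero_Units: "\<lbrakk>a \<in> carrier R; a \<noteq> \<zero>\<rbrakk> \<Longrightarrow> a \<in> Units R"

locale differential_field = additive \<delta> for \<delta> :: "'a::field_char_0 \<Rightarrow> 'a" +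
  assumes Leibniz: "\<delta> (a * b) = \<delta> a * b + a * \<delta> b"

text \<open>
  Differential polynomials over \<open>'a\<close>, i.e. polynomials in the variables
  \<open>X\<^sup>(\<^sup>n\<^sup>)\<close> for \<open>n :: nat\<close>. A monomial \<open>m :: nat \<Rightarrow>\<^sub>0 nat\<close> maps \<open>n\<close> to the exponent
  of \<open>X\<^sup>(\<^sup>n\<^sup>)\<close>, and a polynomial maps monomials to their coefficients.
\<close>

type_synonym 'a diff_poly = "(nat \<Rightarrow>\<^sub>0 nat) \<Rightarrow>\<^sub>0 'a"

definition diff_vars :: "'a::zero diff_poly \<Rightarrow> nat set" where
  "diff_vars f = (\<Union>m\<in>Poly_Mapping.keys f. Poly_Mapping.keys m)"

definition diff_order :: "'a::zero diff_poly \<Rightarrow> int" where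
  "diff_order f = (if diff_vars f = {} then -1 else int (Max (diff_vars f)))"

definition diff_eval :: "('a::field_char_0 \<Rightarrow> 'a) \<Rightarrow> 'a diff_poly \<Rightarrow> 'a \<Rightarrow> 'a" where
  "diff_eval \<delta> f x =
    (\<Sum>m\<in>Poly_Mapping.keys f. Poly_Mapping.lookup f m *
      (\<Prod>n\<in>Poly_Mapping.keys m. ((\<delta> ^^ n) x) ^ Poly_Mapping.lookup m n))"

locale differentially_closed_field = differential_field +
  assumes differentially_closed:
    "\<lbrakk>g \<noteq> 0; diff_order g < diff_order f\<rbrakk> \<Longrightarrow> \<exists>x. diff_eval \<delta> f x = 0 \<and> diff_eval \<delta> g x \<noteq> 0"

definition additive_End :: "('a::ab_group_add \<Rightarrow> 'a) ring" where
  "additive_End =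
    \<lparr>carrier = Collect additive, mult = (\<circ>), one = id,
     zero = (\<lambda>_. 0), add = (\<lambda>f g x. f x + g x)\<rparr>"

lemma ring_additive_End: "ring (additive_End :: ('a::ab_group_add \<Rightarrow> 'a) ring)"
proof (rule ringI)
  have inv: "\<exists>g. additive g \<and> (\<lambda>x. g x + f x) = (\<lambda>_. 0)" if "additive f" for f :: "'a \<Rightarrow> 'a"
    using that by (intro exI[of _ "\<lambda>x. - f x"]) (auto simp: additive_def)
  show "abelian_group (additive_End :: ('a \<Rightarrow> 'a) ring)"
    by (rule abelian_groupI) (use inv in \<open>auto simp: additive_End_def additive_def algebra_simps\<close>)
  show "monoid (additive_End :: ('a \<Rightarrow> 'a) ring)"
    by (rule monoidI) (auto simp: additive_End_def additive_def)
qed (auto simp: additive_End_def additive_def fun_eq_iff)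

definition diff_op_ring :: "('a::field_char_0 \<Rightarrow> 'a) \<Rightarrow> ('a \<Rightarrow> 'a) ring" where
  "diff_op_ring \<delta> = additive_End
    \<lparr>carrier := generate_ring additive_End (insert \<delta> (range (\<lambda>x y. x * y)))\<rparr>"

end

theory Submission
  imports Defs "HOL-Computational_Algebra.Polynomial"
begin

text \<open>
  Write \<open>R = k[\<delta>]\<close> and \<open>L(y)\<close> for the value of an operator \<open>L \<in> R\<close> at \<open>y \<in> k\<close>. That \<open>R\<close> is not a
  division ring is clear: \<open>\<delta>\<close> is nonzero but kills \<open>1\<close>. The point is that \<open>R\<close> is fadelian.

  Fix a nonzero \<open>L\<close>, and call \<open>a \<in> R\<close> good if \<open>R = L R + R a\<close>. Fadelianity says that \<open>L\<close> itself is
  good; separating the two roles of \<open>L\<close> makes it possible to factor \<open>a\<close> while \<open>L\<close> stays fixed,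
  and to show that every nonzero \<open>a\<close> is good. Three observations suffice.

  \<^item> A product of good operators is good (\<open>covers_comp\<close>): if \<open>X = L b + c p\<close> and
    \<open>c = L b' + c' a\<close>, then \<open>X = L (b + b' p) + c' (a p)\<close>. Nonzero elements of \<open>k\<close>, being units
    of \<open>R\<close>, are good.

  \<^item> The operator \<open>\<delta>\<close> is good (\<open>covers_\<delta>\<close>). Modulo \<open>R \<delta>\<close> an operator is determined by its value at
    \<open>1\<close>, so given \<open>X\<close> only a scalar \<open>z\<close> with \<open>L(z) = X(1)\<close> is needed. As \<open>k\<close> is differentially
    closed, the inhomogeneous linear equation \<open>L(z) = X(1)\<close> has a solution.

  \<^item> Every nonzero operator is a product of nonzero elements of \<open>k\<close> and copies of \<open>\<delta>\<close>
    (\<open>lower_degree\<close>). If \<open>a\<close> has positive order, differential closedness gives \<open>y \<noteq> 0\<close> with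
    \<open>a(y) = 0\<close>. Then \<open>a y\<close> (the composite of \<open>a\<close> with multiplication by \<open>y\<close>) kills \<open>1\<close>, hence is
    \<open>a' \<delta>\<close> with \<open>a'\<close> nonzero of smaller order, and \<open>a = a' \<delta> y\<^sup>-\<^sup>1\<close>.

  Operators are represented by ordinary polynomials, \<open>\<Sum> p\<^sub>i T\<^sup>i\<close> standing for \<open>\<Sum> p\<^sub>i \<delta>\<^sup>i\<close>.
  The order of an operator is the degree of a representing polynomial.
\<close>

section \<open>Linear differential operators\<close>

context differential_field
begin

definition diff_op :: "'a poly \<Rightarrow> 'a \<Rightarrow> 'a" where
  "diff_op p x = (\<Sum>i\<le>degree p. coeff p i * (\<delta> ^^ i) x)"

lemma diff_op_altdef:
  assumes "degree p \<le> n"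
  shows "diff_op p x = (\<Sum>i\<le>n. coeff p i * (\<delta> ^^ i) x)"
  unfolding diff_op_def using assms
  by (intro sum.mono_neutral_left) (auto simp: coeff_eq_0)

lemma diff_op_0 [simp]: "diff_op 0 x = 0"
  by (simp add: diff_op_def)

lemma diff_op_pCons [simp]: "diff_op (pCons a p) x = a * x + diff_op p (\<delta> x)"
proof -
  have "diff_op (pCons a p) x = (\<Sum>i\<le>Suc (degree p). coeff (pCons a p) i * (\<delta> ^^ i) x)"
    by (rule diff_op_altdef) (simp add: degree_pCons_le)
  also have "\<dots> = a * x + diff_op p (\<delta> x)"
    unfolding sum.atMost_Suc_shift by (simp add: diff_op_def funpow_swap1)
  finally show ?thesis .
qed

lemma diff_op_add [simp]: "diff_op (p + q) x = diff_op p x + diff_op q x"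
  by (induction p q arbitrary: x rule: poly_induct2) (auto simp: algebra_simps)

lemma diff_op_uminus [simp]: "diff_op (- p) x = - diff_op p x"
  by (induction p arbitrary: x) (auto simp: algebra_simps)

lemma additive_diff_op: "additive (diff_op p)"
proof
  show "diff_op p (x + y) = diff_op p x + diff_op p y" for x y
    by (induction p arbitrary: x y) (auto simp: add algebra_simps)
qed

text \<open>
  The Leibniz rule moves scalars to the left of \<open>\<delta>\<close> without raising the order. It creates new terms
  in lower order only, so the leading coefficient is merely multiplied by the scalar.
\<close>

lemma diff_op_comp_scalar:
  "\<exists>r. (\<forall>x. diff_op r x = diff_op p (y * x)) \<and> degree r \<le> degree p
     \<and> coeff r (degree p) = lead_coeff p * y"
proof (induction p arbitrary: y)
  case 0
  show ?case by (intro exI[of _ 0]) auto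
next
  case (pCons a p)
  show ?case
  proof (cases "p = 0")
    case True
    then show ?thesis by (intro exI[of _ "[:a * y:]"]) (auto simp: algebra_simps)
  next
    case False
    obtain r1 where r1: "\<forall>x. diff_op r1 x = diff_op p (\<delta> y * x)" "degree r1 \<le> degree p"
      using pCons.IH by blast
    obtain r2 where r2: "\<forall>x. diff_op r2 x = diff_op p (y * x)" "degree r2 \<le> degree p"
      "coeff r2 (degree p) = lead_coeff p * y"
      using pCons.IH by blast
    let ?r = "pCons (a * y) r2 + r1"
    have "diff_op ?r x = diff_op (pCons a p) (y * x)" for x
      using r1 r2 by (simp add: Leibniz additive.add[OF additive_diff_op])
    moreover have "degree ?r \<le> degree (pCons a p)"
      using False r1 r2 by (intro degree_add_le) auto
    moreover have "coeff ?r (degree (pCons a p)) = lead_coeff (pCons a p) * y"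
      using False r1 r2 by (simp add: coeff_eq_0)
    ultimately show ?thesis by blast
  qed
qed

lemma diff_op_comp: "\<exists>r. diff_op r = diff_op p \<circ> diff_op q"
proof (induction q)
  case 0
  show ?case by (intro exI[of _ 0]) (auto simp: additive.zero[OF additive_diff_op])
next
  case (pCons b q)
  obtain r where r: "diff_op r = diff_op p \<circ> diff_op q"
    using pCons.IH by blast
  obtain s where s: "\<forall>x. diff_op s x = diff_op p (b * x)"
    using diff_op_comp_scalar by blast
  have "diff_op (s + pCons 0 r) = diff_op p \<circ> diff_op (pCons b q)"
    using r s by (auto simp: additive.add[OF additive_diff_op])
  then show ?case by blast
qed

lemma diff_one: "\<delta> 1 = 0"
  using Leibniz[of 1 1] by simp

abbreviation ops :: "('a \<Rightarrow> 'a) set" where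
  "ops \<equiv> range diff_op"

lemma ops_comp: "f \<in> ops \<Longrightarrow> g \<in> ops \<Longrightarrow> (\<lambda>x. f (g x)) \<in> ops"
proof -
  assume "f \<in> ops" "g \<in> ops"
  then obtain p q where "f = diff_op p" "g = diff_op q" by blast
  then obtain r where "diff_op r = f \<circ> g" using diff_op_comp by blast
  then have "(\<lambda>x. f (g x)) = diff_op r" by (simp add: comp_def)
  then show ?thesis by blast
qed

lemma ops_add: "f \<in> ops \<Longrightarrow> g \<in> ops \<Longrightarrow> (\<lambda>x. f x + g x) \<in> ops"
proof -
  assume "f \<in> ops" "g \<in> ops"
  then obtain p q where "f = diff_op p" "g = diff_op q" by blast
  then have "(\<lambda>x. f x + g x) = diff_op (p + q)" by auto
  then show ?thesis by blast
qed

lemma ops_uminus: "f \<in> ops \<Longrightarrow> (\<lambda>x. - f x) \<in> ops"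
proof -
  assume "f \<in> ops"
  then obtain p where "f = diff_op p" by blast
  then have "(\<lambda>x. - f x) = diff_op (- p)" by auto
  then show ?thesis by blast
qed

lemma ops_scalar: "(\<lambda>x. y * x) \<in> ops"
proof -
  have "(\<lambda>x. y * x) = diff_op [:y:]" by auto
  then show ?thesis by blast
qed

lemma ops_\<delta>: "\<delta> \<in> ops"
proof -
  have "\<delta> = diff_op [:0, 1:]" by auto
  then show ?thesis by blast
qed

lemma ops_zero: "(\<lambda>x. 0) \<in> ops"
  using ops_scalar[of 0] by simp

text \<open>Operators are determined modulo the left ideal generated by \<open>\<delta>\<close> by their value at \<open>1\<close>.\<close>

lemma ops_right_div_\<delta>:
  assumes "f \<in> ops"
  obtains c where "c \<in> ops" "\<And>x. f x = f 1 * x + c (\<delta> x)"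
proof -
  obtain p where p: "f = diff_op p" using assms by blast
  obtain a q where q: "p = pCons a q" by (cases p)
  have "f 1 = a"
    by (simp add: p q diff_one additive.zero[OF additive_diff_op])
  then show ?thesis using that[of "diff_op q"] by (simp add: p q)
qed

section \<open>The ring of operators\<close>

lemma subring_ops: "subring ops additive_End"
proof -
  interpret E: ring "additive_End :: ('a \<Rightarrow> 'a) ring" by (rule ring_additive_End)
  have minus: "\<ominus>\<^bsub>additive_End\<^esub> f = (\<lambda>x. - f x)" if "f \<in> ops" for f
  proof (rule E.minus_equality)
    show "(\<lambda>x. - f x) \<oplus>\<^bsub>additive_End\<^esub> f = \<zero>\<^bsub>additive_End\<^esub>"
      by (simp add: additive_End_def)
    show "f \<in> carrier additive_End" "(\<lambda>x. - f x) \<in> carrier additive_End"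
      using that ops_uminus[OF that] additive_diff_op by (auto simp: additive_End_def)
  qed
  show ?thesis
  proof (rule E.subringI)
    show "ops \<subseteq> carrier additive_End"
      using additive_diff_op by (auto simp: additive_End_def)
    show "\<one>\<^bsub>additive_End\<^esub> \<in> ops"
      using ops_scalar[of 1] by (simp add: additive_End_def id_def)
  next
    fix f assume f: "f \<in> ops"
    show "\<ominus>\<^bsub>additive_End\<^esub> f \<in> ops"
      unfolding minus[OF f] by (rule ops_uminus[OF f])
  next
    fix f g assume "f \<in> ops" "g \<in> ops"
    then show "f \<otimes>\<^bsub>additive_End\<^esub> g \<in> ops" "f \<oplus>\<^bsub>additive_End\<^esub> g \<in> ops"
      using ops_comp ops_add by (auto simp: additive_End_def comp_def)
  qed
qed

lemma generate_ring_eq_ops: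
  "generate_ring additive_End (insert \<delta> (range (\<lambda>x y. x * y))) = ops" (is "generate_ring _ ?H = _")
proof -
  interpret E: ring "additive_End :: ('a \<Rightarrow> 'a) ring" by (rule ring_additive_End)
  have H: "?H \<subseteq> ops" using ops_scalar ops_\<delta> by auto
  have Hc: "?H \<subseteq> carrier additive_End"
    using H subringE(1)[OF subring_ops] by blast
  have "ops = generate_ring additive_End ?H"
  proof (rule E.generate_ringI[OF Hc subring_ops H])
    fix K :: "('a \<Rightarrow> 'a) set" assume K: "subring K additive_End" "?H \<subseteq> K"
    have "diff_op p \<in> K" for p
    proof (induction p)
      case 0
      have "diff_op 0 = \<zero>\<^bsub>additive_End\<^esub>" by (auto simp: additive_End_def)
      then show ?case using subringE(2)[OF K(1)] by simp
    next
      case (pCons a p)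
      have "diff_op (pCons a p)
          = (\<lambda>x. a * x) \<oplus>\<^bsub>additive_End\<^esub> (diff_op p \<otimes>\<^bsub>additive_End\<^esub> \<delta>)"
        by (auto simp: additive_End_def)
      moreover have "(\<lambda>x. a * x) \<in> K" "\<delta> \<in> K" using K(2) by auto
      ultimately show ?case using pCons.IH subringE(6,7)[OF K(1)] by simp
    qed
    then show "ops \<subseteq> K" by blast
  qed
  then show ?thesis ..
qed

lemma diff_op_ring_eq: "diff_op_ring \<delta> = additive_End\<lparr>carrier := ops\<rparr>"
  by (simp add: diff_op_ring_def generate_ring_eq_ops)

lemma ring_diff_op_ring: "ring (diff_op_ring \<delta>)"
  unfolding diff_op_ring_eq
  by (rule ring.subring_is_ring[OF ring_additive_End subring_ops])

lemma diff_op_ring_simps: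
  "carrier (diff_op_ring \<delta>) = ops"
  "f \<otimes>\<^bsub>diff_op_ring \<delta>\<^esub> g = f \<circ> g"
  "f \<oplus>\<^bsub>diff_op_ring \<delta>\<^esub> g = (\<lambda>x. f x + g x)"
  "\<one>\<^bsub>diff_op_ring \<delta>\<^esub> = id"
  "\<zero>\<^bsub>diff_op_ring \<delta>\<^esub> = (\<lambda>_. 0)"
  by (simp_all add: diff_op_ring_eq additive_End_def)

lemma not_skew_field_diff_op_ring:
  assumes "\<delta> \<noteq> (\<lambda>_. 0)"
  shows "\<not> skew_field (diff_op_ring \<delta>)"
proof
  assume "skew_field (diff_op_ring \<delta>)"
  then have "\<delta> \<in> Units (diff_op_ring \<delta>)"
    using assms ops_\<delta> by (intro skew_field.nonzero_Units) (auto simp: diff_op_ring_simps)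
  then obtain f where "f \<in> ops" "f \<circ> \<delta> = id"
    by (auto simp: Units_def diff_op_ring_simps)
  then have "f 0 = 1" "f 0 = 0"
    using diff_one additive.zero[OF additive_diff_op] by (auto simp: fun_eq_iff dest: spec[of _ 1])
  then show False by simp
qed

section \<open>Covering the ring by a right and a left ideal\<close>

text \<open>In ring terms: \<open>R = L R + R a\<close>.\<close>

definition covers :: "('a \<Rightarrow> 'a) \<Rightarrow> ('a \<Rightarrow> 'a) \<Rightarrow> bool" where
  "covers L a \<longleftrightarrow> (\<forall>X\<in>ops. \<exists>b\<in>ops. \<exists>c\<in>ops. \<forall>x. X x = L (b x) + c (a x))"

text \<open>
  Substitute a decomposition of the left coefficient of \<open>p\<close> into a decomposition with respect to
  \<open>p\<close>; the two contributions in \<open>L R\<close> merge since \<open>L\<close> is additive.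
\<close>

lemma covers_comp:
  assumes "additive L" "p \<in> ops" "covers L a" "covers L p"
  shows "covers L (\<lambda>x. a (p x))"
  unfolding covers_def
proof
  fix X assume "X \<in> ops"
  then obtain b c where bc: "b \<in> ops" "c \<in> ops" "\<forall>x. X x = L (b x) + c (p x)"
    using assms(4) unfolding covers_def by blast
  then obtain b' c' where bc': "b' \<in> ops" "c' \<in> ops" "\<forall>x. c x = L (b' x) + c' (a x)"
    using assms(3) unfolding covers_def by blast
  have b'': "(\<lambda>x. b x + b' (p x)) \<in> ops"
    by (rule ops_add[OF bc(1) ops_comp[OF bc'(1) assms(2)]])
  have "\<forall>x. X x = L (b x + b' (p x)) + c' (a (p x))"
    using bc bc' by (simp add: additive.add[OF assms(1)] add_ac)
  then show "\<exists>b\<in>ops. \<exists>c\<in>ops. \<forall>x. X x = L (b x) + c (a (p x))"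
    by (rule bexI[OF bexI[OF _ bc'(2)] b''])
qed

lemma covers_scalar:
  assumes "additive L" "y \<noteq> 0"
  shows "covers L (\<lambda>x. y * x)"
  unfolding covers_def
proof
  fix X assume X: "X \<in> ops"
  have c: "(\<lambda>x. X (inverse y * x)) \<in> ops" by (rule ops_comp[OF X ops_scalar])
  have "\<forall>x. X x = L 0 + X (inverse y * (y * x))"
    using assms by (simp add: additive.zero mult.assoc[symmetric])
  then show "\<exists>b\<in>ops. \<exists>c\<in>ops. \<forall>x. X x = L (b x) + c (y * x)"
    by (rule bexI[OF bexI[OF _ c] ops_zero])
qed

text \<open>
  Here \<open>X\<close> and \<open>L z\<close> agree at \<open>1\<close> for a suitable scalar \<open>z\<close>, so that they differ by an element of
  \<open>R \<delta>\<close>.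
\<close>

lemma covers_\<delta>:
  assumes "L \<in> ops" "surj L"
  shows "covers L \<delta>"
  unfolding covers_def
proof
  fix X assume X: "X \<in> ops"
  obtain z where z: "L z = X 1" using assms(2) by (metis surjD)
  obtain c where c: "c \<in> ops" "\<And>x. X x = X 1 * x + c (\<delta> x)"
    using ops_right_div_\<delta>[OF X] by blast
  obtain d where d: "d \<in> ops" "\<And>x. L (z * x) = X 1 * x + d (\<delta> x)"
    using ops_right_div_\<delta>[OF ops_comp[OF assms(1) ops_scalar[of z]]] z by auto
  obtain e where e: "e \<in> ops" "\<And>x. e x = c x + - d x"
    using ops_add[OF c(1) ops_uminus[OF d(1)]] by blast
  have "X x = L (z * x) + e (\<delta> x)" for x
    using c(2)[of x] d(2)[of x] e(2)[of "\<delta> x"] by simp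
  then show "\<exists>b\<in>ops. \<exists>c\<in>ops. \<forall>x. X x = L (b x) + c (\<delta> x)"
    using e(1) ops_scalar[of z] by blast
qed

text \<open>
  A zero of an operator gives a factor \<open>\<delta> y\<^sup>-\<^sup>1\<close> on the right: after substituting \<open>y x\<close> for \<open>x\<close> the
  constant term is the value at \<open>y\<close>, which vanishes.
\<close>

lemma lower_degree:
  assumes "degree p > 0" "y \<noteq> 0" "diff_op p y = 0"
  obtains q where "q \<noteq> 0" "degree q < degree p" "\<And>x. diff_op p x = diff_op q (\<delta> (inverse y * x))"
proof -
  obtain r where r: "\<forall>x. diff_op r x = diff_op p (y * x)" "degree r \<le> degree p"
    "coeff r (degree p) = lead_coeff p * y"
    using diff_op_comp_scalar by blast
  have "p \<noteq> 0" using assms(1) by auto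
  then have "coeff r (degree p) \<noteq> 0" using r(3) assms(2) by simp
  then have deg: "degree r = degree p"
    using r(2) le_degree by (metis le_antisym)
  obtain a q where q: "r = pCons a q" by (cases r)
  have "q \<noteq> 0" using deg assms(1) q by auto
  moreover have "degree q < degree p" using deg q \<open>q \<noteq> 0\<close> by simp
  moreover have "a = 0"
    using r(1)[rule_format, of 1] assms(3)
    by (simp add: q diff_one additive.zero[OF additive_diff_op])
  then have "diff_op p x = diff_op q (\<delta> (inverse y * x))" for x
    using r(1)[rule_format, of "inverse y * x"] assms(2) by (simp add: q mult.assoc[symmetric])
  ultimately show thesis using that by blast
qed

end

section \<open>Linear differential polynomials\<close>

lemma diff_eval_altdef:
  assumes "finite S" "Poly_Mapping.keys f \<subseteq> S"
  shows "diff_eval \<delta> f x =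
    (\<Sum>m\<in>S. Poly_Mapping.lookup f m *
      (\<Prod>n\<in>Poly_Mapping.keys m. ((\<delta> ^^ n) x) ^ Poly_Mapping.lookup m n))"
  unfolding diff_eval_def using assms
  by (intro sum.mono_neutral_left) (auto simp: in_keys_iff)

lemma diff_eval_zero: "diff_eval \<delta> 0 x = 0"
  by (simp add: diff_eval_def)

lemma diff_eval_add: "diff_eval \<delta> (f + g) x = diff_eval \<delta> f x + diff_eval \<delta> g x"
proof -
  let ?S = "Poly_Mapping.keys f \<union> Poly_Mapping.keys g"
  have "finite ?S" "Poly_Mapping.keys (f + g) \<subseteq> ?S"
    using keys_add[of f g] by simp_all
  then show ?thesis
    by (simp add: diff_eval_altdef[of ?S] lookup_add distrib_right sum.distrib)
qed

lemma diff_eval_sum: "diff_eval \<delta> (\<Sum>i\<in>I. f i) x = (\<Sum>i\<in>I. diff_eval \<delta> (f i) x)"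
  by (induction I rule: infinite_finite_induct) (simp_all add: diff_eval_zero diff_eval_add)

lemma diff_eval_const: "diff_eval \<delta> (Poly_Mapping.single 0 c) x = c"
  by (simp add: diff_eval_def)

lemma diff_eval_var:
  "diff_eval \<delta> (Poly_Mapping.single (Poly_Mapping.single n 1) a) x = a * (\<delta> ^^ n) x"
  by (simp add: diff_eval_def)

definition affine_diff_poly :: "'a::field_char_0 poly \<Rightarrow> 'a \<Rightarrow> 'a diff_poly" where
  "affine_diff_poly p c =
    (\<Sum>i\<le>degree p. Poly_Mapping.single (Poly_Mapping.single i 1) (coeff p i))
      + Poly_Mapping.single 0 (- c)"

lemma (in differential_field) diff_eval_affine:
  "diff_eval \<delta> (affine_diff_poly p c) x = diff_op p x - c"
  unfolding affine_diff_poly_def diff_eval_add diff_eval_sum diff_eval_const diff_eval_var diff_op_def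
  by simp

lemma diff_order_affine:
  assumes "p \<noteq> 0"
  shows "diff_order (affine_diff_poly p c) = int (degree p)"
proof -
  let ?f = "affine_diff_poly p c" and ?n = "degree p"
  have single_eq: "Poly_Mapping.single i (1::nat) = Poly_Mapping.single ?n 1 \<longleftrightarrow> i = ?n" for i
    by (metis keys_single one_neq_zero singleton_inject)
  have "Poly_Mapping.single ?n (1::nat) \<noteq> 0"
    by (metis lookup_single_eq lookup_zero one_neq_zero)
  then have "Poly_Mapping.lookup ?f (Poly_Mapping.single ?n 1)
      = (\<Sum>i\<le>?n. if i = ?n then coeff p i else 0)"
    unfolding affine_diff_poly_def lookup_add lookup_sum
    by (auto simp: lookup_single when_def single_eq simp del: One_nat_def intro!: sum.cong)
  also have "\<dots> = lead_coeff p" by simp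
  finally have "Poly_Mapping.single ?n 1 \<in> Poly_Mapping.keys ?f"
    using assms by (simp add: in_keys_iff)
  then have top: "?n \<in> diff_vars ?f" by (force simp: diff_vars_def)
  have "Poly_Mapping.keys ?f \<subseteq> insert 0 ((\<lambda>i. Poly_Mapping.single i 1) ` {..?n})"
    unfolding affine_diff_poly_def
    by (rule order_trans[OF keys_add] Un_least order_trans[OF keys_sum])+ (auto split: if_splits)
  then have le: "diff_vars ?f \<subseteq> {..?n}"
    by (force simp: diff_vars_def)
  then have "Max (diff_vars ?f) = ?n"
    using top by (intro Max_eqI) (auto intro: finite_subset)
  then show ?thesis using top by (auto simp: diff_order_def)
qed

section \<open>Differentially closed fields\<close>

context differentially_closed_field
begin

text \<open>
  The equation \<open>L(x) = c\<close> alone is the case \<open>g = 1\<close> of the closure axiom. As \<open>1\<close> has order \<open>-1\<close>,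
  operators of order \<open>0\<close> are admissible as well.
\<close>

lemma diff_op_surj:
  assumes "p \<noteq> 0"
  shows "surj (diff_op p)"
  unfolding surj_def
proof
  fix c
  have "diff_order (1 :: 'a diff_poly) < diff_order (affine_diff_poly p c)"
    using assms by (simp add: diff_order_affine diff_order_def[of 1] diff_vars_def)
  then obtain x where "diff_eval \<delta> (affine_diff_poly p c) x = 0"
    using differentially_closed[of 1] by auto
  then show "\<exists>x. c = diff_op p x" by (auto simp: diff_eval_affine)
qed

text \<open>The inequation \<open>X \<noteq> 0\<close> has order \<open>0\<close>, which is why the order of the operator must be positive.\<close>

lemma diff_op_root:
  assumes "degree p > 0"
  obtains y where "y \<noteq> 0" "diff_op p y = 0"
proof -
  let ?X = "Poly_Mapping.single (Poly_Mapping.single 0 1) 1 :: 'a diff_poly"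
  have "p \<noteq> 0" using assms by auto
  then have "diff_order ?X < diff_order (affine_diff_poly p 0)"
    using assms unfolding diff_order_affine[OF \<open>p \<noteq> 0\<close>] by (simp add: diff_order_def diff_vars_def)
  moreover have "?X \<noteq> 0"
    by (metis lookup_single_eq lookup_zero one_neq_zero)
  ultimately obtain y where "diff_eval \<delta> (affine_diff_poly p 0) y = 0" "diff_eval \<delta> ?X y \<noteq> 0"
    using differentially_closed by blast
  then show thesis
    using that[of y] by (auto simp: diff_eval_affine diff_eval_var[of _ 0, simplified])
qed

text \<open>Induction on the order of the operator on the right, splitting off a factor \<open>\<delta> y\<^sup>-\<^sup>1\<close>.\<close>

lemma covers_diff_op:
  assumes L: "L \<in> ops" "surj L" and "p \<noteq> 0"
  shows "covers L (diff_op p)"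
  using assms(3)
proof (induction "degree p" arbitrary: p rule: less_induct)
  case less
  have add: "additive L" using L(1) additive_diff_op by blast
  show ?case
  proof (cases "degree p = 0")
    case True
    then obtain a where "p = [:a:]" by (rule degree_eq_zeroE)
    then have "a \<noteq> 0" "diff_op p = (\<lambda>x. a * x)" using less.prems by auto
    then show ?thesis using covers_scalar[OF add] by simp
  next
    case False
    then obtain y where y: "y \<noteq> 0" "diff_op p y = 0" using diff_op_root by blast
    obtain q where q: "q \<noteq> 0" "degree q < degree p"
        and p: "\<And>x. diff_op p x = diff_op q (\<delta> (inverse y * x))"
      using lower_degree[OF _ y] False by blast
    have "covers L (\<lambda>x. \<delta> (inverse y * x))"
      by (rule covers_comp[OF add ops_scalar covers_\<delta>[OF L] covers_scalar[OF add]])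
        (use y in simp)
    then have "covers L (\<lambda>x. diff_op q (\<delta> (inverse y * x)))"
      by (rule covers_comp[OF add ops_comp[OF ops_\<delta> ops_scalar] less.hyps[OF q(2,1)]])
    then show ?thesis by (simp flip: p)
  qed
qed

lemma fadelian_diff_op_ring: "fadelian_ring (diff_op_ring \<delta>)"
proof (intro fadelian_ring.intro fadelian_ring_axioms.intro)
  show "ring (diff_op_ring \<delta>)" by (rule ring_diff_op_ring)
  show "\<one>\<^bsub>diff_op_ring \<delta>\<^esub> \<noteq> \<zero>\<^bsub>diff_op_ring \<delta>\<^esub>"
    by (auto simp: diff_op_ring_simps fun_eq_iff intro: exI[of _ 1])
next
  fix X a
  assume X: "X \<in> carrier (diff_op_ring \<delta>)" and a: "a \<in> carrier (diff_op_ring \<delta>)"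
    "a \<noteq> \<zero>\<^bsub>diff_op_ring \<delta>\<^esub>"
  then obtain p where p: "a = diff_op p" by (auto simp: diff_op_ring_simps)
  have "p \<noteq> 0" using a(2) p by (auto simp: diff_op_ring_simps)
  then have "covers a a"
    using covers_diff_op[OF _ diff_op_surj] p by blast
  then obtain b c where "b \<in> ops" "c \<in> ops" "\<forall>x. X x = a (b x) + c (a x)"
    using X by (force simp: covers_def diff_op_ring_simps)
  then show "\<exists>b\<in>carrier (diff_op_ring \<delta>). \<exists>c\<in>carrier (diff_op_ring \<delta>).
      X = a \<otimes>\<^bsub>diff_op_ring \<delta>\<^esub> b \<oplus>\<^bsub>diff_op_ring \<delta>\<^esub> c \<otimes>\<^bsub>diff_op_ring \<delta>\<^esub> a"
    by (intro bexI[of _ b] bexI[of _ c]) (auto simp: diff_op_ring_simps)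
qed

end

theorem corollary7:
  fixes \<delta> :: "'a::field_char_0 \<Rightarrow> 'a"
  assumes "differentially_closed_field \<delta>"
    and "\<delta> \<noteq> (\<lambda>_. 0)"
  shows "fadelian_ring (diff_op_ring \<delta>) \<and> \<not> skew_field (diff_op_ring \<delta>)"
proof -
  interpret differentially_closed_field \<delta> by (rule assms(1))
  show ?thesis
    using fadelian_diff_op_ring not_skew_field_diff_op_ring[OF assms(2)] by blast
qed

end
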